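(* Let $\mathcal H$ be a real Hilbert space, let $f\in\Gamma_0(\mathcal H)$ be such that $\operatorname{lev}_{\leq 0}f\neq\varnothing$, let $U$ be a selection of $\partial f$, and let $x\in\mathcal H$ be such that $f(x)>0$ and $x\in\operatorname{int}\operatorname{dom}U$. Then the following are equivalent: (i) $G_f^U$ is continuous at $x$. (ii) $U$ is continuous at $x$. (iii) $f$ is Fréchet differentiable at $x$.
   Context: Continuity is with respect to the norm topology. $\Gamma_0(\mathcal H)$ is the set of proper convex lower semicontinuous functions $\mathcal H\to]-\infty,+\infty]$; $\operatorname{lev}_{\leq 0}f=\{x: f(x)\leq 0\}$. $\partial f$ is the convex subdifferential, $\operatorname{dom}\partial f=\{x:\partial f(x)\neq\varnothing\}$. A selection of $\partial f$ is a map $U$ defined on some subset $\operatorname{dom}U\subset\operatorname{dom}\partial f$ with $Ux\in\partial f(x)$ for all $x\in\operatorname{dom}U$. $G_f^U$ is the single-valued map with domain $\operatorname{lev}_{\leq 0}f\cup\operatorname{dom}U$ given by $G_f^Ux=x$ if $f(x)\leq0$ and $G_f^Ux=x-\frac{f(x)}{\|Ux\|^2}Ux$ if $f(x)>0$ and $x\in\operatorname{dom}U$ (subgradients at points where $f>0$ are nonzero because $\operatorname{lev}_{\leq 0}f\neq\varnothing$). *)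

theory Defs
  imports "HOL-Analysis.Analysis"
begin

definition eff_dom :: "('a \<Rightarrow> ereal) \<Rightarrow> 'a set" where
  "eff_dom f = {x. f x < \<infinity>}"

definition proper_fun :: "('a \<Rightarrow> ereal) \<Rightarrow> bool" where
  "proper_fun f \<longleftrightarrow> (\<forall>x. f x \<noteq> -\<infinity>) \<and> eff_dom f \<noteq> {}"

text \<open>Convexity of an extended-real-valued function means convexity of its epigraph, a subset of
  the product of the space with the (finite) reals.\<close>

definition convex_fun :: "('a::real_vector \<Rightarrow> ereal) \<Rightarrow> bool" where
  "convex_fun f \<longleftrightarrow> convex {(x, r::real). f x \<le> ereal r}"

definition lsc_fun :: "('a::topological_space \<Rightarrow> ereal) \<Rightarrow> bool" where
  "lsc_fun f \<longleftrightarrow> (\<forall>x. f x \<le> Liminf (nhds x) f)"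

definition Gamma0 :: "('a::real_normed_vector \<Rightarrow> ereal) set" where
  "Gamma0 = {f. proper_fun f \<and> convex_fun f \<and> lsc_fun f}"

definition lev_le0 :: "('a \<Rightarrow> ereal) \<Rightarrow> 'a set" where
  "lev_le0 f = {x. f x \<le> 0}"

definition subdiff :: "('a::real_inner \<Rightarrow> ereal) \<Rightarrow> 'a \<Rightarrow> 'a set" where
  "subdiff f x = {u. \<forall>y. ereal ((y - x) \<bullet> u) + f x \<le> f y}"

definition dom_subdiff :: "('a::real_inner \<Rightarrow> ereal) \<Rightarrow> 'a set" where
  "dom_subdiff f = {x. subdiff f x \<noteq> {}}"

text \<open>Single-valued maps defined on a subset of the space are partial functions, so that
  \<open>dom\<close> is their domain. Continuity at a point of the domain refers to the subspace
  topology of the domain.\<close>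

definition pcontinuous_at ::
  "('a::t2_space \<rightharpoonup> 'b::topological_space) \<Rightarrow> 'a \<Rightarrow> bool" where
  "pcontinuous_at T x \<longleftrightarrow> x \<in> dom T \<and> continuous (at x within dom T) (\<lambda>y. the (T y))"

definition selection :: "('a::real_inner \<Rightarrow> ereal) \<Rightarrow> ('a \<rightharpoonup> 'a) \<Rightarrow> bool" where
  "selection f U \<longleftrightarrow> dom U \<subseteq> dom_subdiff f \<and> (\<forall>x\<in>dom U. the (U x) \<in> subdiff f x)"

text \<open>The domain of the subgradient projector is \<open>lev_le0 f \<union> dom U\<close>. If \<open>f\<close> is
  proper, \<open>f x\<close> is finite at every point of \<open>dom_subdiff f\<close>, so \<open>real_of_ereal\<close> is
  only applied to finite values when \<open>U\<close> is a selection.\<close>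

definition subgrad_proj :: "('a::real_inner \<Rightarrow> ereal) \<Rightarrow> ('a \<rightharpoonup> 'a) \<Rightarrow> ('a \<rightharpoonup> 'a)" where
  "subgrad_proj f U x =
     (if f x \<le> 0 then Some x
      else (case U x of
              None \<Rightarrow> None
            | Some u \<Rightarrow> Some (x - (real_of_ereal (f x) / (norm u)\<^sup>2) *\<^sub>R u)))"

text \<open>The library's \<open>differentiable\<close> asks for a bounded linear derivative, i.e. it is Frechet
  differentiability. The interiority condition makes \<open>f\<close> less than infinity around
  \<open>x\<close>, so that for proper \<open>f\<close> passing to real values is harmless.\<close>

definition frechet_differentiable_at :: "('a::real_normed_vector \<Rightarrow> ereal) \<Rightarrow> 'a \<Rightarrow> bool" where
  "frechet_differentiable_at f x \<longleftrightarrow>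
     x \<in> interior (eff_dom f) \<and> (\<lambda>y. real_of_ereal (f y)) differentiable (at x)"

lemma dom_subgrad_proj: "dom (subgrad_proj f U) = lev_le0 f \<union> dom U"
  by (auto simp: subgrad_proj_def lev_le0_def dom_def split: option.splits if_splits)

end

theory Submission
  imports Defs
begin

text \<open>On the open set \<open>interior (dom U)\<close> the two subgradient inequalities between \<open>x\<close> and
  \<open>y\<close> give \<open>0 \<le> f y - f x - \<langle>y - x, U x\<rangle> \<le> \<parallel>y - x\<parallel> \<parallel>U y - U x\<parallel>\<close>, so continuity of \<open>U\<close> at \<open>x\<close>
  forces differentiability; conversely, for \<open>\<parallel>y - x\<parallel> < s\<close>, testing \<open>U y - U x\<close>
  against vectors of length \<open>s\<close> bounds \<open>s \<parallel>U y - U x\<parallel>\<close> by the remainder of the first-order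
  expansion of \<open>f\<close> at \<open>x\<close> on the ball of radius \<open>2 * s\<close>.
  The displacement \<open>w = Id - G\<close> satisfies \<open>U = (f / \<parallel>w\<parallel>\<^sup>2) w\<close> and \<open>\<parallel>U\<parallel> = f / \<parallel>w\<parallel>\<close> where \<open>f > 0\<close>;
  continuity of \<open>w\<close> thus bounds \<open>U\<close> in terms of \<open>f\<close>, and the subgradient inequalities then
  yield continuity of \<open>f\<close>, hence of \<open>U\<close>.\<close>

text \<open>Real-valued and relative to a set, so that the analysis near \<open>x\<close> is free of
  \<open>ereal\<close> arithmetic and partial maps.\<close>

definition subgradients_on :: "'a set \<Rightarrow> ('a::real_inner \<Rightarrow> real) \<Rightarrow> ('a \<Rightarrow> 'a) \<Rightarrow> bool" where
  "subgradients_on S g u \<longleftrightarrow> (\<forall>y\<in>S. \<forall>z\<in>S. g y + (z - y) \<bullet> u y \<le> g z)"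

lemma subgradients_onD:
  "subgradients_on S g u \<Longrightarrow> y \<in> S \<Longrightarrow> z \<in> S \<Longrightarrow> g y + (z - y) \<bullet> u y \<le> g z"
  by (simp add: subgradients_on_def)

lemma has_derivative_if_subgradients_continuous:
  assumes "open S" "x \<in> S" and sub: "subgradients_on S g u" and "isCont u x"
  shows "(g has_derivative (\<lambda>h. h \<bullet> u x)) (at x)"
proof -
  obtain e where "e > 0" and e: "\<And>y. dist y x < e \<Longrightarrow> y \<in> S"
    using assms(1,2) by (metis open_dist)
  show ?thesis
  proof (rule has_derivativeI_sandwich[OF \<open>e > 0\<close>])
    show "bounded_linear (\<lambda>h. h \<bullet> u x)"
      by (rule bounded_linear_inner_left)
    fix y assume y: "y \<noteq> x" "dist y x < e"
    have "g x + (y - x) \<bullet> u x \<le> g y" "g y + (x - y) \<bullet> u y \<le> g x"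
      using subgradients_onD[OF sub] e[OF y(2)] \<open>x \<in> S\<close> by blast+
    then have "norm (g y - g x - (y - x) \<bullet> u x) \<le> (y - x) \<bullet> (u y - u x)"
      by (simp add: inner_diff)
    also have "\<dots> \<le> norm (y - x) * norm (u y - u x)"
      by (rule norm_cauchy_schwarz)
    finally show "norm ((g y - g x) - (y - x) \<bullet> u x) / norm (y - x) \<le> norm (u y - u x)"
      using y(1) by (simp add: divide_le_eq mult.commute)
  next
    show "((\<lambda>y. norm (u y - u x)) \<longlongrightarrow> 0) (at x)"
      using \<open>isCont u x\<close> by (simp add: isCont_def LIM_zero tendsto_norm_zero)
  qed
qed

text \<open>Subtracting the affine minorant given by \<open>u x\<close> leaves a function that is
  minimal over \<open>S\<close> at \<open>x\<close>, so its derivative vanishes there.\<close>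

lemma subgradient_eq_derivative:
  assumes "open S" "x \<in> S" and sub: "subgradients_on S g u" and "(g has_derivative D) (at x)"
  shows "D h = h \<bullet> u x"
proof -
  have "((\<lambda>y. g y - (y - x) \<bullet> u x) has_derivative (\<lambda>h. D h - h \<bullet> u x)) (at x)"
    using assms(4) by (auto intro!: derivative_eq_intros)
  moreover have "\<forall>y\<in>S. g x - (x - x) \<bullet> u x \<le> g y - (y - x) \<bullet> u x"
    using subgradients_onD[OF sub \<open>x \<in> S\<close>] by (auto simp: algebra_simps)
  ultimately have "(\<lambda>h. D h - h \<bullet> u x) = (\<lambda>v. 0)"
    using differential_zero_maxmin[of x S "\<lambda>y. g y - (y - x) \<bullet> u x"] assms(1,2) by blast
  then show ?thesis
    by (metis eq_iff_diff_eq_0)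
qed

lemma subgradients_continuous_if_differentiable:
  assumes "open S" "x \<in> S" and sub: "subgradients_on S g u" and "g differentiable (at x)"
  shows "isCont u x"
proof -
  obtain D where D: "(g has_derivative D) (at x)"
    using assms(4) by (auto simp: differentiable_def)
  obtain r where "r > 0" and r: "\<And>y. dist y x < r \<Longrightarrow> y \<in> S"
    using assms(1,2) by (metis open_dist)
  have "\<exists>d>0. \<forall>y. dist y x < d \<longrightarrow> dist (u y) (u x) < e" if "e > 0" for e
  proof -
    have "e / 4 > 0"
      using that by simp
    then obtain d where "d > 0"
      and d: "\<And>y. norm (y - x) < d \<Longrightarrow> norm (g y - g x - D (y - x)) \<le> e / 4 * norm (y - x)"
      using D unfolding has_derivative_at_alt by blast
    \<comment> \<open>Half the minimum, so that both \<open>y\<close> and its translate by a vector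
      of length \<open>s\<close> stay in \<open>S\<close> and in the range of the first-order
      estimate.\<close>
    define s where "s = min r d / 2"
    have s: "s > 0" "2 * s \<le> r" "2 * s \<le> d"
      using \<open>r > 0\<close> \<open>d > 0\<close> by (auto simp: s_def)
    have "dist (u y) (u x) < e" if y: "dist y x < s" for y
    proof (cases "u y = u x")
      case False
      \<comment> \<open>The direction for which Cauchy-Schwarz against \<open>u y - u x\<close> is
        an equality.\<close>
      define h where "h = (s / norm (u y - u x)) *\<^sub>R (u y - u x)"
      have nh: "norm h = s"
        using False s by (simp add: h_def)
      have hu: "h \<bullet> (u y - u x) = s * norm (u y - u x)"
        using False by (simp add: h_def power2_norm_eq_inner[symmetric] power2_eq_square)
      have yh: "norm (y + h - x) < 2 * s"
        using norm_triangle_ineq[of "y - x" h] y nh by (simp add: dist_norm algebra_simps)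
      have inS: "y \<in> S" "y + h \<in> S"
        using r y yh s by (auto simp: dist_norm)
      have "norm (y + h - x) < d"
        using yh s by linarith
      from d[OF this] have "g (y + h) - g x - D (y + h - x) \<le> e / 4 * norm (y + h - x)"
        unfolding real_norm_def by (rule order_trans[OF abs_ge_self])
      then have "g (y + h) - g x - (y + h - x) \<bullet> u x \<le> e / 4 * norm (y + h - x)"
        by (simp only: subgradient_eq_derivative[OF assms(1,2) sub D])
      also have "\<dots> < e / 4 * (2 * s)"
        using yh \<open>e / 4 > 0\<close> by (rule mult_strict_left_mono)
      finally have up: "g (y + h) - g x - (y + h - x) \<bullet> u x < e / 2 * s"
        by simp
      \<comment> \<open>Adding the two inequalities cancels \<open>g y\<close> and bounds
        \<open>h \<bullet> (u y - u x)\<close> by the first-order remainder at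
        \<open>y + h\<close>.\<close>
      have "g y + h \<bullet> u y \<le> g (y + h)" "g x + (y - x) \<bullet> u x \<le> g y"
        using subgradients_onD[OF sub inS] subgradients_onD[OF sub \<open>x \<in> S\<close> inS(1)] by simp_all
      with up have "h \<bullet> (u y - u x) < e / 2 * s"
        by (simp add: inner_diff inner_add)
      then have "norm (u y - u x) < e / 2"
        using s by (simp add: hu mult.commute)
      then show ?thesis
        using \<open>e > 0\<close> by (simp add: dist_norm)
    qed (use \<open>e > 0\<close> in simp)
    then show ?thesis
      using s(1) by blast
  qed
  then show ?thesis
    unfolding continuous_at_eps_delta by blast
qed

lemma continuous_if_displacement_continuous:
  assumes "open S" "x \<in> S" and sub: "subgradients_on S g u"
    and pos: "\<And>y. y \<in> S \<Longrightarrow> g y > 0" and nz: "\<And>y. y \<in> S \<Longrightarrow> u y \<noteq> 0"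
    and cont: "isCont (\<lambda>y. (g y / (norm (u y))\<^sup>2) *\<^sub>R u y) x"
  shows "isCont u x"
proof -
  define w where "w = (\<lambda>y. (g y / (norm (u y))\<^sup>2) *\<^sub>R u y)"
  have w: "isCont w x"
    using cont by (simp add: w_def)
  have nw: "norm (w y) = g y / norm (u y)" if "y \<in> S" for y
    using pos[OF that] nz[OF that] by (simp add: w_def power2_eq_square)
  have wx: "w x \<noteq> 0"
    using nw[OF \<open>x \<in> S\<close>] pos[OF \<open>x \<in> S\<close>] nz[OF \<open>x \<in> S\<close>] by (metis divide_eq_0_iff less_irrefl norm_eq_zero)
  have evS: "\<forall>\<^sub>F y in at x. y \<in> S"
    using assms(1,2) by (auto simp: eventually_at_topological)
  have u: "u y = (g y / (norm (w y))\<^sup>2) *\<^sub>R w y" if "y \<in> S" for y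
    unfolding nw[OF that] using pos[OF that] nz[OF that]
    by (simp add: w_def power_divide power2_eq_square)
  \<comment> \<open>The upper estimate for \<open>g y\<close> will contain
    \<open>norm (y - x) * g y / norm (w y)\<close>. Moving this term to the left leaves
    \<open>g y\<close> times the present factor, which tends to 1 and may eventually be divided
    by.\<close>
  have q: "((\<lambda>y. 1 - norm (y - x) / norm (w y)) \<longlongrightarrow> 1 - norm (x - x) / norm (w x)) (at x)"
    using w wx unfolding isCont_def by (intro tendsto_intros) simp_all
  have gx: "(g \<longlongrightarrow> g x) (at x)"
  proof (rule tendsto_sandwich)
    have "((\<lambda>y. g x + (y - x) \<bullet> u x) \<longlongrightarrow> g x + (x - x) \<bullet> u x) (at x)"
      by (intro tendsto_intros)
    then show "((\<lambda>y. g x + (y - x) \<bullet> u x) \<longlongrightarrow> g x) (at x)"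
      by simp
    show "\<forall>\<^sub>F y in at x. g x + (y - x) \<bullet> u x \<le> g y"
      using evS by eventually_elim (rule subgradients_onD[OF sub \<open>x \<in> S\<close>])
    show "((\<lambda>y. g x / (1 - norm (y - x) / norm (w y))) \<longlongrightarrow> g x) (at x)"
      using tendsto_divide[OF tendsto_const[of "g x"] q] by simp
    have "\<forall>\<^sub>F y in at x. 1 - norm (y - x) / norm (w y) > 0"
      using order_tendstoD(1)[OF q, of 0] by simp
    with evS show "\<forall>\<^sub>F y in at x. g y \<le> g x / (1 - norm (y - x) / norm (w y))"
    proof eventually_elim
      case (elim y)
      have "g y \<le> g x + (y - x) \<bullet> u y"
        using subgradients_onD[OF sub elim(1) \<open>x \<in> S\<close>] by (simp add: inner_diff)
      also have "(y - x) \<bullet> u y \<le> norm (y - x) * norm (u y)"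
        by (rule norm_cauchy_schwarz)
      also have "norm (u y) = g y / norm (w y)"
        using nw[OF elim(1)] pos[OF elim(1)] nz[OF elim(1)] by simp
      finally show ?case
        using elim(2) by (simp add: pos_le_divide_eq algebra_simps)
    qed
  qed
  have "((\<lambda>y. (g y / (norm (w y))\<^sup>2) *\<^sub>R w y) \<longlongrightarrow> (g x / (norm (w x))\<^sup>2) *\<^sub>R w x) (at x)"
    using gx w wx unfolding isCont_def by (intro tendsto_intros) simp_all
  then have "(u \<longlongrightarrow> (g x / (norm (w x))\<^sup>2) *\<^sub>R w x) (at x)"
    by (rule Lim_transform_eventually) (use evS in eventually_elim, simp add: u)
  then show ?thesis
    by (simp add: isCont_def u[OF \<open>x \<in> S\<close>, symmetric])
qed

lemma displacement_continuous_if_subgradients_continuous: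
  assumes "open S" "x \<in> S" and "subgradients_on S g u" and "isCont u x" and "u x \<noteq> 0"
  shows "isCont (\<lambda>y. (g y / (norm (u y))\<^sup>2) *\<^sub>R u y) x"
proof -
  have "isCont g x"
    using has_derivative_if_subgradients_continuous[OF assms(1-4)] by (rule has_derivative_continuous)
  with assms(4,5) show ?thesis
    by (intro continuous_intros) simp_all
qed

text \<open>The value \<open>\<infinity>\<close> at \<open>x\<close> would propagate through the
  subgradient inequality to every point.\<close>

lemma subdiff_finite:
  assumes "proper_fun f" "u \<in> subdiff f x"
  shows "\<bar>f x\<bar> \<noteq> \<infinity>"
proof -
  obtain y where "f y < \<infinity>"
    using assms(1) by (auto simp: proper_fun_def eff_dom_def)
  moreover have "ereal ((y - x) \<bullet> u) + f x \<le> f y"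
    using assms(2) by (simp add: subdiff_def)
  ultimately have "f x \<noteq> \<infinity>"
    by auto
  with assms(1) show ?thesis
    by (auto simp: proper_fun_def)
qed

text \<open>Near an interior point the subspace topology of the domain is invisible, so
  \<open>U\<close> and the projector, whose domains may differ, can be compared as total
  functions.\<close>

lemma pcontinuous_at_iff_isCont:
  assumes "open S" "x \<in> S" "S \<subseteq> dom T" and eq: "\<And>y. y \<in> S \<Longrightarrow> the (T y) = h y"
  shows "pcontinuous_at T x \<longleftrightarrow> isCont h x"
proof -
  have "at x within dom T = at x"
    using assms(1-3) by (metis at_within_interior interior_maximal subsetD)
  then have "pcontinuous_at T x \<longleftrightarrow> isCont (\<lambda>y. the (T y)) x"
    using assms(2,3) by (auto simp: pcontinuous_at_def)
  also have "\<dots> \<longleftrightarrow> isCont h x"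
    by (rule isCont_cong) (use assms(1,2) eq in \<open>auto simp: eventually_nhds\<close>)
  finally show ?thesis .
qed

theorem proposition3p2:
  fixes f :: "'h::{real_inner, complete_space} \<Rightarrow> ereal"
    and U :: "'h \<rightharpoonup> 'h"
    and x :: 'h
  assumes "f \<in> Gamma0"
    and "lev_le0 f \<noteq> {}"
    and "selection f U"
    and "f x > 0"
    and "x \<in> interior (dom U)"
  shows "(pcontinuous_at (subgrad_proj f U) x \<longleftrightarrow> pcontinuous_at U x)
       \<and> (pcontinuous_at U x \<longleftrightarrow> frechet_differentiable_at f x)"
proof -
  define g where "g = (\<lambda>y. real_of_ereal (f y))"
  define u where "u = (\<lambda>y. the (U y))"
  \<comment> \<open>Positivity of the affine minorant at \<open>x\<close> is an open condition and
    forces \<open>g\<close> to be positive, so the projector uses its second formula throughout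
    \<open>S\<close>.\<close>
  define S where "S = interior (dom U) \<inter> {y. 0 < g x + (y - x) \<bullet> u x}"
  have proper: "proper_fun f"
    using assms(1) by (simp add: Gamma0_def)
  have usub: "u y \<in> subdiff f y" if "y \<in> dom U" for y
    using assms(3) that by (simp add: selection_def u_def)
  have fg: "f y = ereal (g y)" if "y \<in> dom U" for y
    using subdiff_finite[OF proper usub[OF that]] by (simp add: g_def ereal_real)
  have sub: "subgradients_on (dom U) g u"
    unfolding subgradients_on_def
  proof (intro ballI)
    fix y z assume y: "y \<in> dom U" and z: "z \<in> dom U"
    have "ereal ((z - y) \<bullet> u y) + f y \<le> f z"
      using usub[OF y] by (simp add: subdiff_def)
    then show "g y + (z - y) \<bullet> u y \<le> g z"
      by (simp add: fg[OF y] fg[OF z] add.commute)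
  qed
  have xdom: "x \<in> dom U"
    using assms(5) interior_subset by blast
  have SU: "S \<subseteq> dom U"
    unfolding S_def using interior_subset by blast
  have "open {y. 0 < g x + (y - x) \<bullet> u x}"
    by (intro open_Collect_less continuous_intros)
  then have S: "open S" "x \<in> S"
    using assms(4,5) fg[OF xdom] by (auto simp: S_def)
  have subS: "subgradients_on S g u"
    unfolding subgradients_on_def using subgradients_onD[OF sub] SU by blast
  have pos: "g y > 0" if "y \<in> S" for y
  proof -
    have "0 < g x + (y - x) \<bullet> u x"
      using that by (simp add: S_def)
    also have "\<dots> \<le> g y"
      using that SU by (intro subgradients_onD[OF sub xdom]) blast
    finally show ?thesis .
  qed
  \<comment> \<open>A zero subgradient would make \<open>y\<close> a global minimizer with positive
    value, although \<open>lev_le0 f\<close> is nonempty.\<close>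
  have nz: "u y \<noteq> 0" if "y \<in> S" for y
  proof
    assume "u y = 0"
    obtain z where "f z \<le> 0"
      using assms(2) by (auto simp: lev_le0_def)
    moreover have "f y \<le> f z"
      using usub[OF subsetD[OF SU that]] \<open>u y = 0\<close> by (simp add: subdiff_def)
    ultimately have "f y \<le> 0"
      by order
    then show False
      using pos[OF that] by (simp add: fg[OF subsetD[OF SU that]])
  qed
  have U: "pcontinuous_at U x \<longleftrightarrow> isCont u x"
    by (rule pcontinuous_at_iff_isCont[OF S SU]) (simp add: u_def)
  have "pcontinuous_at (subgrad_proj f U) x \<longleftrightarrow> isCont (\<lambda>y. y - (g y / (norm (u y))\<^sup>2) *\<^sub>R u y) x"
  proof (rule pcontinuous_at_iff_isCont[OF S])
    show "S \<subseteq> dom (subgrad_proj f U)"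
      using SU by (auto simp: dom_subgrad_proj)
    fix y assume y: "y \<in> S"
    then obtain v where "U y = Some v"
      using SU by blast
    moreover have "\<not> f y \<le> 0"
      using pos[OF y] by (simp add: fg[OF subsetD[OF SU y]])
    ultimately show "the (subgrad_proj f U y) = y - (g y / (norm (u y))\<^sup>2) *\<^sub>R u y"
      by (simp add: subgrad_proj_def g_def u_def)
  qed
  also have "\<dots> \<longleftrightarrow> isCont (\<lambda>y. (g y / (norm (u y))\<^sup>2) *\<^sub>R u y) x"
    (is "isCont (\<lambda>y. y - ?w y) x \<longleftrightarrow> _")
  proof
    assume "isCont (\<lambda>y. y - ?w y) x"
    from continuous_diff[OF continuous_ident this] show "isCont ?w x"
      by simp
  qed (rule continuous_diff[OF continuous_ident])
  also have "\<dots> \<longleftrightarrow> isCont u x"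
    using continuous_if_displacement_continuous[OF S subS pos nz]
      displacement_continuous_if_subgradients_continuous[OF S subS _ nz[OF S(2)]] by blast
  finally have GU: "pcontinuous_at (subgrad_proj f U) x \<longleftrightarrow> isCont u x" .
  have "dom U \<subseteq> eff_dom f"
    by (rule subsetI) (simp add: eff_dom_def fg)
  then have "x \<in> interior (eff_dom f)"
    using assms(5) interior_mono by blast
  then have "frechet_differentiable_at f x \<longleftrightarrow> g differentiable (at x)"
    by (simp add: frechet_differentiable_at_def g_def)
  also have "\<dots> \<longleftrightarrow> isCont u x"
    using has_derivative_if_subgradients_continuous[OF S subS]
      subgradients_continuous_if_differentiable[OF S subS] by (auto intro: differentiableI)
  finally show ?thesis
    using U GU by blast
qed

end
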